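(* Let $A\in\mathbb{R}^{n\times n}$, $B\in\mathbb{R}^{n\times n_u}$, $C\in\mathbb{R}^{n_y\times n}$ with $(A,C)$ observable, $K\in\mathbb{R}^{n_u\times n}$, $L_c,N_c\in\mathbb{R}^{n\times n_y}$, $\theta=\theta^T\in\mathbb{R}^{n_y\times n_y}$ with $\theta\ge 0$ (so $C^T\theta C\ge0$), and let $P=P^T\in\mathbb{R}^{n\times n}$ be positive definite such that (i) there is no $v\in\mathbb{R}^n$, $v\neq 0$, with $(A-L_cC)v+(v^TC^T\theta Cv)\,N_cCv=0$; (ii) $(A-L_cC)^TP+P(A-L_cC)<0$; (iii) $PN_cC+C^TN_c^TP<0$. Then the closed loop system formed by the plant $\dot x=Ax+Bu$, $y=Cx$, the cubic observer $$\dot{\hat x}_c=(A-L_cC)\hat x_c+L_cy+Bu-(e_c^TC^T\theta Ce_c)N_cCe_c,\qquad e_c=x-\hat x_c,$$ and the feedback $u=-K\hat x_c$ is stable if $P$ and a symmetric positive definite $P_1\in\mathbb{R}^{n\times n}$ fulfill $$\begin{bmatrix}(A-BK)^TP_1+P_1(A-BK) & P_1BK\\ K^TB^TP_1 & (A-L_cC)^TP+P(A-L_cC)\end{bmatrix}<0 .$$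
   Context: For symmetric matrices, $M<0$ means negative definite and $M\ge 0$ positive semidefinite. In the variables $(x,e_c)$ the closed loop is $\dot x=(A-BK)x+BKe_c$, $\dot e_c=(A-L_cC)e_c+(e_c^TC^T\theta Ce_c)N_cCe_c$. "Stable" is used without further specification; the argument uses the Lyapunov function $x^TP_1x+e_c^TPe_c$. *)

theory Defs
  imports "HOL-Analysis.Analysis"
begin

definition neg_definite :: "real^'m^'m \<Rightarrow> bool" where
  "neg_definite M \<longleftrightarrow> transpose M = M \<and> (\<forall>v. v \<noteq> 0 \<longrightarrow> v \<bullet> (M *v v) < 0)"

definition pos_definite :: "real^'m^'m \<Rightarrow> bool" where
  "pos_definite M \<longleftrightarrow> transpose M = M \<and> (\<forall>v. v \<noteq> 0 \<longrightarrow> v \<bullet> (M *v v) > 0)"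

definition pos_semidefinite :: "real^'m^'m \<Rightarrow> bool" where
  "pos_semidefinite M \<longleftrightarrow> transpose M = M \<and> (\<forall>v. v \<bullet> (M *v v) \<ge> 0)"

text \<open>The matrix with rows \<open>[M11 M12]\<close> and \<open>[M21 M22]\<close>; the sum types index the
  block rows and block columns.\<close>

definition block_matrix ::
  "real^'c^'a \<Rightarrow> real^'d^'a \<Rightarrow> real^'c^'b \<Rightarrow> real^'d^'b \<Rightarrow> real^('c + 'd)^('a + 'b)" where
  "block_matrix M11 M12 M21 M22 =
     (\<chi> i j. case i of
        Inl a \<Rightarrow> (case j of Inl c \<Rightarrow> M11 $ a $ c | Inr d \<Rightarrow> M12 $ a $ d)
      | Inr b \<Rightarrow> (case j of Inl c \<Rightarrow> M21 $ b $ c | Inr d \<Rightarrow> M22 $ b $ d))"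

definition is_solution :: "('s::real_normed_vector \<Rightarrow> 's) \<Rightarrow> real set \<Rightarrow> (real \<Rightarrow> 's) \<Rightarrow> bool" where
  "is_solution f J z \<longleftrightarrow> (\<forall>t\<in>J. (z has_vector_derivative f (z t)) (at t within J))"

text \<open>The initial state is determined by the output over some finite horizon.  By linearity a
  known input does not matter, so the unforced system is used.\<close>

definition observable :: "real^'n^'n \<Rightarrow> real^'n^'y \<Rightarrow> bool" where
  "observable A C \<longleftrightarrow>
     (\<exists>T>0. \<forall>x1 x2.
        is_solution (\<lambda>x. A *v x) {0..T} x1 \<longrightarrow> is_solution (\<lambda>x. A *v x) {0..T} x2 \<longrightarrow>
        (\<forall>t\<in>{0..T}. C *v x1 t = C *v x2 t) \<longrightarrow> x1 0 = x2 0)"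

text \<open>Stability in the sense of Lyapunov of the equilibrium \<open>0\<close>.  Solutions on every compact
  interval are considered, so that a trajectory with finite escape time violates the bound and is
  not merely left out of account.\<close>

definition lyapunov_stable :: "('s::real_normed_vector \<Rightarrow> 's) \<Rightarrow> bool" where
  "lyapunov_stable f \<longleftrightarrow> f 0 = 0 \<and>
     (\<forall>\<epsilon>>0. \<exists>\<delta>>0. \<forall>T>0. \<forall>z. is_solution f {0..T} z \<longrightarrow> norm (z 0) < \<delta> \<longrightarrow>
        (\<forall>t\<in>{0..T}. norm (z t) < \<epsilon>))"

text \<open>Global attractivity includes that a solution exists for all forward time from every initial
  state; otherwise its last clause could hold vacuously.\<close>

definition globally_asymptotically_stable :: "('s::real_normed_vector \<Rightarrow> 's) \<Rightarrow> bool" where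
  "globally_asymptotically_stable f \<longleftrightarrow> lyapunov_stable f \<and>
     (\<forall>z0. \<exists>z. z 0 = z0 \<and> is_solution f {0..} z) \<and>
     (\<forall>z. is_solution f {0..} z \<longrightarrow> (z \<longlongrightarrow> 0) at_top)"

definition plant :: "real^'n^'n \<Rightarrow> real^'u^'n \<Rightarrow> real^'n \<Rightarrow> real^'u \<Rightarrow> real^'n" where
  "plant A B x u = A *v x + B *v u"

text \<open>Right-hand side of the observer at estimate \<open>xh\<close>, input \<open>u\<close>, measured output \<open>y\<close> and
  estimation error \<open>e\<close>.  The error enters only through \<open>C *v e\<close>, which is \<open>y - C *v xh\<close> in the
  interconnection below.\<close>

definition cubic_observer ::
  "real^'n^'n \<Rightarrow> real^'u^'n \<Rightarrow> real^'n^'y \<Rightarrow> real^'y^'n \<Rightarrow> real^'y^'n \<Rightarrow> real^'y^'y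
     \<Rightarrow> real^'n \<Rightarrow> real^'u \<Rightarrow> real^'y \<Rightarrow> real^'n \<Rightarrow> real^'n" where
  "cubic_observer A B C Lc Nc \<theta> xh u y e =
     (A - Lc ** C) *v xh + Lc *v y + B *v u
       - (e \<bullet> ((transpose C ** \<theta> ** C) *v e)) *\<^sub>R (Nc *v (C *v e))"

text \<open>The vector field of the interconnection; its state is the pair of plant state and estimate.\<close>

definition closed_loop ::
  "real^'n^'n \<Rightarrow> real^'u^'n \<Rightarrow> real^'n^'y \<Rightarrow> real^'n^'u \<Rightarrow> real^'y^'n \<Rightarrow> real^'y^'n \<Rightarrow> real^'y^'y
     \<Rightarrow> (real^'n) \<times> (real^'n) \<Rightarrow> (real^'n) \<times> (real^'n)" where
  "closed_loop A B C K Lc Nc \<theta> = (\<lambda>(x, xh).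
     let u = - (K *v xh); y = C *v x; e = x - xh
     in (plant A B x u, cubic_observer A B C Lc Nc \<theta> xh u y e))"

lemma closed_loop_error_coordinates:
  fixes x e :: "real^'n"
  assumes "closed_loop A B C K Lc Nc \<theta> (x, x - e) = (dx, dxh)"
  shows "dx = (A - B ** K) *v x + (B ** K) *v e"
    and "dx - dxh = (A - Lc ** C) *v e
           + (e \<bullet> ((transpose C ** \<theta> ** C) *v e)) *\<^sub>R ((Nc ** C) *v e)"
  using assms
  by (auto simp: closed_loop_def plant_def cubic_observer_def Let_def
      matrix_vector_mult_diff_rdistrib matrix_vector_mult_diff_distrib
      matrix_vector_mul_assoc[symmetric] linear_neg[OF matrix_vector_mul_linear])

end

theory Submission
  imports Defs
begin

text \<open>
  In the coordinates \<open>x\<close> and \<open>e = x - xh\<close> the function \<open>V = x\<^sup>T P1 x + e\<^sup>T P e\<close> has along the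
  closed loop the derivative
    \<open>w\<^sup>T M w + (e\<^sup>T C\<^sup>T \<theta> C e) \<cdot> e\<^sup>T (P Nc C + C\<^sup>T Nc\<^sup>T P) e\<close>,
  where \<open>w\<close> stacks \<open>x\<close> and \<open>e\<close> and \<open>M\<close> is the block matrix that the theorem takes to be negative
  definite (\<open>lyapunov_form_closed_loop\<close>).  The cubic term of the observer contributes a
  nonnegative factor times a nonpositive one, so only the quadratic term counts.  By compactness of
  the unit sphere a definite quadratic form is bounded away from zero by a multiple of the squared
  norm.  Hence the derivative of \<open>V\<close> is at most \<open>- c\<close> times the squared norm of the state, thus at
  most \<open>- k V\<close> for some \<open>k > 0\<close>, and \<open>V\<close> decays exponentially along every solution
  (\<open>lyapunov_decay\<close>).  This gives both Lyapunov stability and global attractivity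
  (\<open>quadratic_lyapunov_imp_globally_asymptotically_stable\<close>).

  The remaining point is that solutions exist for all forward time, although the vector field grows
  cubically.  For a globally Lipschitz field this is the Picard-Lindeloef theorem, which a norm with
  exponential weight yields on the whole half-line by a single contraction
  (\<open>lipschitz_imp_global_solution\<close>).  A locally Lipschitz field \<open>f\<close> is replaced by \<open>f \<circ> \<pi>\<close>, where
  \<open>\<pi>\<close> is the nearest-point projection onto a large ball about \<open>0\<close>.  Since \<open>\<pi>\<close> only rescales its
  argument by a positive factor and the gradient of \<open>V\<close> is linear, \<open>V\<close> does not increase along the
  modified field either, at any point of the space.  So a solution of the modified equation never
  leaves the sublevel set of \<open>V\<close> in which it starts; if the ball contains that set, it solves the
  original equation as well (\<open>quadratic_lyapunov_imp_global_solution\<close>), without any continuation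
  argument.
\<close>

section \<open>Initial value problems with a globally Lipschitz right-hand side\<close>

lemma integral_has_vector_derivative_halfline:
  fixes h :: "real \<Rightarrow> 's::banach"
  assumes h: "continuous_on UNIV h" and t: "0 \<le> t"
  shows "((\<lambda>t. integral {0..t} h) has_vector_derivative h t) (at t within {0..})"
proof -
  have "continuous_on {0..t+1} h"
    using h by (rule continuous_on_subset) simp
  then have "((\<lambda>t. integral {0..t} h) has_vector_derivative h t) (at t within {0..t+1})"
    using t by (intro integral_has_vector_derivative) auto
  moreover have "at t within {0..} = at t within {0..t+1}"
    by (rule at_within_nhd[where S="{..<t+1}"]) auto
  ultimately show ?thesis by simp
qed

text \<open>This makes the Picard operator a contraction in the weighted norm: after multiplication by
  \<open>exp (- k t)\<close>, integration of functions of growth \<open>exp (k s)\<close> gains the factor \<open>1 / k\<close>, uniformly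
  in \<open>t\<close>.\<close>

lemma norm_integral_le_exp:
  fixes h :: "real \<Rightarrow> 's::banach"
  assumes h: "continuous_on UNIV h" and k: "0 < k" and c: "0 \<le> c" and t: "0 \<le> t"
    and bound: "\<And>s. 0 \<le> s \<Longrightarrow> norm (h s) \<le> c * exp (k * s)"
  shows "norm (exp (- k * t) *\<^sub>R integral {0..t} h) \<le> c / k"
proof -
  have "((\<lambda>s. c * exp (k * s)) has_integral c / k * exp (k * t) - c / k * exp (k * 0)) {0..t}"
    using t k
    by (intro fundamental_theorem_of_calculus)
       (auto simp: has_real_derivative_iff_has_vector_derivative[symmetric]
         intro!: derivative_eq_intros)
  then have I: "integral {0..t} (\<lambda>s. c * exp (k * s)) = c / k * exp (k * t) - c / k"
    and i: "(\<lambda>s. c * exp (k * s)) integrable_on {0..t}"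
    by (simp_all add: integral_unique has_integral_integrable del: integral_mult_right)
  have "h integrable_on {0..t}"
    by (intro integrable_continuous_real continuous_on_subset[OF h]) simp
  then have "norm (integral {0..t} h) \<le> integral {0..t} (\<lambda>s. c * exp (k * s))"
    using bound i by (intro integral_norm_bound_integral) auto
  also have "\<dots> \<le> c / k * exp (k * t)"
    using I c k by simp
  finally have "exp (- k * t) * norm (integral {0..t} h) \<le> exp (- k * t) * (c / k * exp (k * t))"
    by (intro mult_left_mono) auto
  also have "\<dots> = c / k"
    by (simp add: exp_minus field_simps)
  finally show ?thesis by simp
qed

text \<open>The unknown of the fixed-point equation is \<open>y t = exp (- k t) (z t - z0)\<close>, a bounded
  continuous function.  For \<open>k > L\<close> the Picard operator contracts the supremum norm of \<open>y\<close> by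
  \<open>L / k\<close>, so the solution is found on \<open>[0, \<infinity>)\<close> without gluing solutions on short intervals.\<close>

theorem lipschitz_imp_global_solution:
  fixes g :: "'s::banach \<Rightarrow> 's"
  assumes L: "L-lipschitz_on UNIV g"
  shows "\<exists>z. z 0 = z0 \<and> is_solution g {0..} z"
proof -
  define k where "k = L + 1"
  have L0: "0 \<le> L" and k0: "0 < k" 
    using lipschitz_on_nonneg[OF L] by (auto simp: k_def)
  have gcont: "continuous_on UNIV g"
    using L by (rule lipschitz_on_continuous_on)
  define h where "h = (\<lambda>(y::real \<Rightarrow>\<^sub>C 's) s. g (z0 + exp (k * s) *\<^sub>R apply_bcontfun y s))"
  have hcont: "continuous_on UNIV (h y)" for y
    unfolding h_def
    by (intro continuous_on_compose2[OF gcont] continuous_intros) auto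
  \<comment> \<open>\<open>h y\<close> is the right-hand side along the curve encoded by \<open>y\<close>; \<open>I y\<close> encodes its Picard iterate.\<close>
  define I where "I = (\<lambda>y t. exp (- k * t) *\<^sub>R integral {0..t} (h y))"
  have hdiff: "norm (h y s - h y' s) \<le> (L * dist y y') * exp (k * s)" for y y' s
  proof -
    have "norm (h y s - h y' s) \<le> L * norm (exp (k * s) *\<^sub>R (apply_bcontfun y s - apply_bcontfun y' s))"
      using lipschitz_onD[OF L, of "z0 + exp (k * s) *\<^sub>R apply_bcontfun y s" "z0 + exp (k * s) *\<^sub>R apply_bcontfun y' s"]
      by (simp add: h_def dist_norm scaleR_diff_right)
    also have "\<dots> = L * (exp (k * s) * dist (apply_bcontfun y s) (apply_bcontfun y' s))"
      by (simp add: dist_norm)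
    also have "\<dots> \<le> L * (exp (k * s) * dist y y')"
      using L0 by (intro mult_left_mono dist_bounded) auto
    finally show ?thesis by (simp add: mult_ac)
  qed
  have hbound: "norm (h y s) \<le> (norm (g z0) + L * dist y 0) * exp (k * s)" if "0 \<le> s" for y s
  proof -
    have "norm (h y s) \<le> norm (h 0 s) + norm (h y s - h 0 s)"
      by (metis add.commute diff_add_cancel norm_triangle_ineq)
    also have "\<dots> \<le> norm (g z0) * 1 + (L * dist y 0) * exp (k * s)"
      using hdiff[of y s 0] by (simp add: h_def)
    also have "\<dots> \<le> norm (g z0) * exp (k * s) + (L * dist y 0) * exp (k * s)"
      using that k0 L0 by (intro add_mono mult_left_mono) auto
    finally show ?thesis by (simp add: algebra_simps)
  qed
  have Icont: "continuous_on {0..} (I y)" for y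
  proof -
    have "continuous_on {0..} (\<lambda>t. integral {0..t} (h y))"
      using integral_has_vector_derivative_halfline[OF hcont]
      by (auto simp: continuous_on_eq_continuous_within intro!: has_vector_derivative_continuous)
    then show ?thesis
      unfolding I_def by (intro continuous_intros)
  qed
  have bcont: "(\<lambda>t. I y (max 0 t)) \<in> bcontfun" for y
  proof (rule bcontfun_normI)
    show "continuous_on UNIV (\<lambda>t. I y (max 0 t))"
      by (intro continuous_on_compose2[OF Icont] continuous_intros) auto
    show "norm (I y (max 0 t)) \<le> (norm (g z0) + L * dist y 0) / k" for t
      unfolding I_def using L0 k0 hbound
      by (intro norm_integral_le_exp hcont max.cobounded1) auto
  qed
  \<comment> \<open>Times before \<open>0\<close> are clamped to \<open>0\<close>, since the function space consists of functions on the whole line.\<close>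
  define F where "F = (\<lambda>y. Bcontfun (\<lambda>t. I y (max 0 t)))"
  have F: "apply_bcontfun (F y) t = I y (max 0 t)" for y t
    unfolding F_def using bcont by (simp add: Bcontfun_inverse)
  have "dist (F y) (F y') \<le> L / k * dist y y'" for y y'
  proof (rule dist_bound)
    fix t :: real
    define r where "r = max 0 t"
    have r: "0 \<le> r" by (simp add: r_def)
    have "I y r - I y' r = exp (- k * r) *\<^sub>R integral {0..r} (\<lambda>s. h y s - h y' s)"
      unfolding I_def
      by (subst integral_diff)
         (auto simp: scaleR_diff_right intro!: integrable_continuous_real continuous_on_subset[OF hcont])
    also have "norm \<dots> \<le> (L * dist y y') / k"
      using L0 k0 r hdiff by (intro norm_integral_le_exp continuous_intros hcont) auto
    finally show "dist (apply_bcontfun (F y) t) (apply_bcontfun (F y') t) \<le> L / k * dist y y'"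
      by (simp add: F dist_norm r_def)
  qed
  moreover have "L / k < 1" "0 \<le> L / k"
    using L0 by (auto simp: k_def)
  ultimately have "\<exists>!y. F y = y"
    by (intro banach_fix_type[of "L / k"]) auto
  then obtain y where y: "F y = y" by blast
  define z where "z = (\<lambda>t. z0 + integral {0..t} (h y))"
  have z: "h y t = g (z t)" if "0 \<le> t" for t
  proof -
    have "apply_bcontfun y t = I y t"
      using F[of y t] that y by simp
    then show ?thesis
      by (simp add: h_def z_def I_def exp_minus)
  qed
  have "(z has_vector_derivative g (z t)) (at t within {0..})" if "0 \<le> t" for t
    using integral_has_vector_derivative_halfline[OF hcont that, of y] z[OF that]
    unfolding z_def by (auto intro!: derivative_eq_intros)
  then show ?thesis
    by (intro exI[of _ z]) (auto simp: is_solution_def z_def)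
qed

section \<open>Quadratic Lyapunov functions\<close>

lemma is_solution_subset:
  assumes "is_solution f S z" "T \<subseteq> S"
  shows "is_solution f T z"
  using assms unfolding is_solution_def
  by (meson has_vector_derivative_within_subset subsetD)

text \<open>The function \<open>exp (k t) V (z t)\<close> is nonincreasing, where \<open>V z = \<beta> z z\<close>.  The case \<open>k = 0\<close>
  confines solutions to sublevel sets; \<open>k > 0\<close> gives exponential decay.\<close>

lemma lyapunov_decay:
  fixes z z' :: "real \<Rightarrow> 's::real_normed_vector" and \<beta> :: "'s \<Rightarrow> 's \<Rightarrow> real"
  assumes \<beta>: "bounded_bilinear \<beta>" and sym: "\<And>x y. \<beta> x y = \<beta> y x"
    and z: "\<And>t. t \<in> {0..T} \<Longrightarrow> (z has_vector_derivative z' t) (at t within {0..T})"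
    and decay: "\<And>t. t \<in> {0..T} \<Longrightarrow> 2 * \<beta> (z t) (z' t) \<le> - k * \<beta> (z t) (z t)"
    and t: "t \<in> {0..T}"
  shows "\<beta> (z t) (z t) \<le> exp (- k * t) * \<beta> (z 0) (z 0)"
proof -
  define W where "W = (\<lambda>t. exp (k * t) * \<beta> (z t) (z t))"
  have W: "(W has_real_derivative
      exp (k * t) * (k * \<beta> (z t) (z t) + 2 * \<beta> (z t) (z' t))) (at t within {0..T})"
    if "t \<in> {0..T}" for t
  proof -
    have "((\<lambda>t. \<beta> (z t) (z t)) has_real_derivative 2 * \<beta> (z t) (z' t)) (at t within {0..T})"
      using bounded_bilinear.has_vector_derivative[OF \<beta> z[OF that] z[OF that]] sym
      by (simp add: has_real_derivative_iff_has_vector_derivative)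
    then show ?thesis
      unfolding W_def by (auto intro!: derivative_eq_intros simp: algebra_simps)
  qed
  have "W t \<le> W 0"
  proof (rule DERIV_nonpos_imp_decreasing_open[where f = W and a = 0 and b = t])
    show "0 \<le> t" using t by simp
    have "continuous_on {0..T} W"
      using W by (intro DERIV_continuous_on) auto
    then show "continuous_on {0..t} W"
      using t by (elim continuous_on_subset) auto
    fix x assume x: "0 < x" "x < t"
    then have "(W has_real_derivative
      exp (k * x) * (k * \<beta> (z x) (z x) + 2 * \<beta> (z x) (z' x))) (at x)"
      using W[of x] t by (auto simp: at_within_Icc_at)
    moreover have "exp (k * x) * (k * \<beta> (z x) (z x) + 2 * \<beta> (z x) (z' x)) \<le> 0"
      using decay[of x] x t by (intro mult_nonneg_nonpos) auto
    ultimately show "\<exists>y. (W has_real_derivative y) (at x) \<and> y \<le> 0"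
      by blast
  qed
  then show ?thesis
    by (simp add: W_def exp_minus field_simps)
qed

lemma closest_point_cball_radial:
  fixes z :: "'s::euclidean_space"
  assumes R: "0 < R"
  obtains s where "0 < s" "closest_point (cball 0 R) z = s *\<^sub>R z"
proof (cases "norm z \<le> R")
  case True
  then show ?thesis
    using that[of 1] by (simp add: closest_point_self)
next
  case False
  have "dist z ((R / norm z) *\<^sub>R z) \<le> dist z y" if y: "y \<in> cball 0 R" for y
  proof -
    have "z - (R / norm z) *\<^sub>R z = (1 - R / norm z) *\<^sub>R z"
      by (simp add: scaleR_diff_left)
    then have "dist z ((R / norm z) *\<^sub>R z) = (1 - R / norm z) * norm z"
      using False R by (auto simp add: dist_norm abs_of_nonneg divide_le_eq)
    also have "\<dots> = norm z - R"
      using False R by (auto simp: field_simps)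
    also have "\<dots> \<le> norm z - norm y"
      using y by simp
    also have "\<dots> \<le> dist z y"
      unfolding dist_norm by (rule norm_triangle_ineq2)
    finally show ?thesis .
  qed
  then have "(R / norm z) *\<^sub>R z = closest_point (cball 0 R) z"
    using False R by (intro closest_point_unique) auto
  moreover have "0 < R / norm z"
    using False R by (intro divide_pos_pos) linarith+
  ultimately show ?thesis
    using that[of "R / norm z"] by simp
qed

text \<open>Precomposition with the projection onto a ball makes \<open>f\<close> globally Lipschitz.  The new field
  still satisfies the Lyapunov inequality at every point \<open>y\<close>: with \<open>\<pi> y = s y\<close> and \<open>s > 0\<close>,
  \<open>s \<cdot> \<beta> y (f (\<pi> y)) = \<beta> (\<pi> y) (f (\<pi> y)) \<le> 0\<close>.\<close>

lemma quadratic_lyapunov_imp_global_solution: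
  fixes f :: "'s::euclidean_space \<Rightarrow> 's" and \<beta> :: "'s \<Rightarrow> 's \<Rightarrow> real"
  assumes \<beta>: "bounded_bilinear \<beta>" and sym: "\<And>x y. \<beta> x y = \<beta> y x"
    and a: "0 < a" "\<And>z. a * (norm z)\<^sup>2 \<le> \<beta> z z"
    and decay: "\<And>z. \<beta> z (f z) \<le> 0"
    and lip: "\<And>R. \<exists>L. L-lipschitz_on (cball 0 R) f"
  shows "\<exists>z. z 0 = z0 \<and> is_solution f {0..} z"
proof -
  \<comment> \<open>The ball of radius \<open>R\<close> contains the sublevel set of \<open>z0\<close>; the summand \<open>1\<close> keeps \<open>R\<close> positive
    for \<open>z0 = 0\<close>.\<close>
  define R where "R = sqrt (\<beta> z0 z0 / a) + 1"
  have V0: "0 \<le> \<beta> z0 z0"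
    using a(1) a(2)[of z0] by (smt (verit) mult_nonneg_nonneg zero_le_power2)
  have R: "0 < R"
    unfolding R_def using V0 a(1) by (simp add: add_nonneg_pos)
  define \<pi> where "\<pi> = (closest_point (cball (0::'s) R))"
  have \<pi>_in: "\<pi> z \<in> cball 0 R" for z
    unfolding \<pi>_def using R by (intro closest_point_in_set) auto
  obtain L where L: "L-lipschitz_on (cball 0 R) f"
    using lip by blast
  have "L-lipschitz_on UNIV (f \<circ> \<pi>)"
  proof (rule lipschitz_onI)
    fix x y
    have "dist ((f \<circ> \<pi>) x) ((f \<circ> \<pi>) y) \<le> L * dist (\<pi> x) (\<pi> y)"
      using lipschitz_onD[OF L \<pi>_in \<pi>_in] by simp
    also have "\<dots> \<le> L * dist x y"
      unfolding \<pi>_def using R lipschitz_on_nonneg[OF L]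
      by (intro mult_left_mono closest_point_lipschitz) auto
    finally show "dist ((f \<circ> \<pi>) x) ((f \<circ> \<pi>) y) \<le> L * dist x y" .
  qed (rule lipschitz_on_nonneg[OF L])
  then obtain z where z0: "z 0 = z0" and z: "is_solution (f \<circ> \<pi>) {0..} z"
    using lipschitz_imp_global_solution by blast
  have decay': "\<beta> y (f (\<pi> y)) \<le> 0" for y
  proof -
    obtain s where s: "0 < s" "\<pi> y = s *\<^sub>R y"
      unfolding \<pi>_def using closest_point_cball_radial[OF R] by blast
    have "s * \<beta> y (f (\<pi> y)) = \<beta> (\<pi> y) (f (\<pi> y))"
      using s by (simp add: bounded_bilinear.scaleR_left[OF \<beta>])
    also have "\<dots> \<le> 0" by (rule decay)
    finally show ?thesis
      using s(1) by (simp add: mult_le_0_iff)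
  qed
  have "\<pi> (z t) = z t" if t: "0 \<le> t" for t
  proof -
    have "\<beta> (z t) (z t) \<le> exp (- 0 * t) * \<beta> (z 0) (z 0)"
    proof (rule lyapunov_decay[OF \<beta> sym, where T = t])
      fix s assume "s \<in> {0..t}"
      then show "(z has_vector_derivative f (\<pi> (z s))) (at s within {0..t})"
        using is_solution_subset[OF z, of "{0..t}"] by (auto simp: is_solution_def)
    qed (use t decay' in auto)
    then have "a * (norm (z t))\<^sup>2 \<le> \<beta> z0 z0"
      using a(2)[of "z t"] z0 by simp
    then have "norm (z t) \<le> sqrt (\<beta> z0 z0 / a)"
      using a(1) by (intro real_le_rsqrt) (simp add: field_simps)
    then show ?thesis
      unfolding \<pi>_def by (intro closest_point_self) (simp add: R_def)
  qed
  then have "is_solution f {0..} z"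
    using z by (auto simp: is_solution_def)
  with z0 show ?thesis by blast
qed

text \<open>Between its bounds \<open>a \<bar>z\<bar>\<^sup>2\<close> and \<open>b \<bar>z\<bar>\<^sup>2\<close>, the decay of the form at rate \<open>k = c / b\<close> becomes the
  estimate \<open>\<bar>z t\<bar> \<le> sqrt (b / a) \<bar>z 0\<bar> exp (- k t / 2)\<close>, from which stability and attractivity are read
  off.\<close>

theorem quadratic_lyapunov_imp_globally_asymptotically_stable:
  fixes f :: "'s::euclidean_space \<Rightarrow> 's" and \<beta> :: "'s \<Rightarrow> 's \<Rightarrow> real"
  assumes \<beta>: "bounded_bilinear \<beta>" and sym: "\<And>x y. \<beta> x y = \<beta> y x"
    and a: "0 < a" "\<And>z. a * (norm z)\<^sup>2 \<le> \<beta> z z"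
    and c: "0 < c" "\<And>z. 2 * \<beta> z (f z) \<le> - c * (norm z)\<^sup>2"
    and f0: "f 0 = 0"
    and lip: "\<And>R. \<exists>L. L-lipschitz_on (cball 0 R) f"
  shows "globally_asymptotically_stable f"
proof -
  obtain b where b: "0 < b" "\<And>x y. norm (\<beta> x y) \<le> norm x * norm y * b"
    using bounded_bilinear.pos_bounded[OF \<beta>] by blast
  have upper: "\<beta> z z \<le> b * (norm z)\<^sup>2" for z
    using b(2)[of z z] by (simp add: power2_eq_square mult_ac)
  define k where "k = c / b"
  have k: "0 < k" using b(1) c(1) by (simp add: k_def)
  have decay: "2 * \<beta> z (f z) \<le> - k * \<beta> z z" for z
  proof -
    have "k * \<beta> z z \<le> k * (b * (norm z)\<^sup>2)"
      using upper k by (intro mult_left_mono) auto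
    then show ?thesis using c(2)[of z] b(1) by (simp add: k_def)
  qed
  define q where "q = sqrt (b / a)"
  have q: "0 < q" using a(1) b(1) by (simp add: q_def)
  have est: "norm (z t) \<le> q * norm (z 0) * exp (- (k / 2) * t)"
    if "is_solution f {0..T} z" "t \<in> {0..T}" for z t T
  proof -
    have "\<beta> (z t) (z t) \<le> exp (- k * t) * \<beta> (z 0) (z 0)"
      using that decay by (intro lyapunov_decay[OF \<beta> sym]) (auto simp: is_solution_def)
    also have "\<dots> \<le> exp (- k * t) * (b * (norm (z 0))\<^sup>2)"
      using upper by (intro mult_left_mono) auto
    finally have "a * (norm (z t))\<^sup>2 \<le> exp (- k * t) * (b * (norm (z 0))\<^sup>2)"
      using a(2)[of "z t"] by linarith
    then have "(norm (z t))\<^sup>2 \<le> b / a * (norm (z 0))\<^sup>2 * exp (- k * t)"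
      using a(1) by (simp add: field_simps)
    also have "exp (- k * t) = (exp (- (k / 2) * t))\<^sup>2"
      by (simp add: power2_eq_square exp_add[symmetric])
    also have "b / a = q\<^sup>2"
      using a(1) b(1) by (simp add: q_def)
    finally have "(norm (z t))\<^sup>2 \<le> (q * norm (z 0) * exp (- (k / 2) * t))\<^sup>2"
      by (simp only: power_mult_distrib)
    then show ?thesis
      using q by (elim power2_le_imp_le) simp
  qed
  have "lyapunov_stable f"
    unfolding lyapunov_stable_def
  proof (intro conjI allI impI f0)
    fix \<epsilon> :: real assume \<epsilon>: "0 < \<epsilon>"
    show "\<exists>\<delta>>0. \<forall>T>0. \<forall>z. is_solution f {0..T} z \<longrightarrow> norm (z 0) < \<delta> \<longrightarrow>
        (\<forall>t\<in>{0..T}. norm (z t) < \<epsilon>)"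
    proof (intro exI[of _ "\<epsilon> / q"] conjI allI impI ballI)
      fix T t :: real and z
      assume z: "is_solution f {0..T} z" "norm (z 0) < \<epsilon> / q" "t \<in> {0..T}"
      have "norm (z t) \<le> q * norm (z 0) * exp (- (k / 2) * t)"
        using est z by blast
      also have "\<dots> \<le> q * norm (z 0) * 1"
        using q k z(3) by (intro mult_left_mono) auto
      also have "\<dots> < \<epsilon>"
        using z(2) q by (simp add: field_simps)
      finally show "norm (z t) < \<epsilon>" .
    qed (use \<epsilon> q in auto)
  qed
  moreover have "\<exists>z. z 0 = z0 \<and> is_solution f {0..} z" for z0
  proof (rule quadratic_lyapunov_imp_global_solution[OF \<beta> sym a])
    show "\<beta> z (f z) \<le> 0" for z
      using c(1) c(2)[of z] by (smt (verit) mult_nonneg_nonneg mult_minus_left zero_le_power2)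
  qed (use lip in auto)
  moreover have "(z \<longlongrightarrow> 0) at_top" if z: "is_solution f {0..} z" for z
  proof (rule Lim_null_comparison)
    show "\<forall>\<^sub>F t in at_top. norm (z t) \<le> q * norm (z 0) * exp (- (k / 2) * t)"
      using eventually_ge_at_top[of 0]
    proof eventually_elim
      case (elim t)
      have "is_solution f {0..t} z"
        using z by (rule is_solution_subset) simp
      then show ?case
        using est elim by auto
    qed
    have "((\<lambda>t. exp (- (k / 2) * t)) \<longlongrightarrow> 0) at_top"
      using k
      by (intro filterlim_compose[OF exp_at_bot] filterlim_tendsto_neg_mult_at_bot[OF tendsto_const _ filterlim_ident]) auto
    then show "((\<lambda>t. q * norm (z 0) * exp (- (k / 2) * t)) \<longlongrightarrow> 0) at_top"
      by (rule tendsto_mult_right_zero)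
  qed
  ultimately show ?thesis
    unfolding globally_asymptotically_stable_def by blast
qed

section \<open>Definite matrices and block matrices\<close>

text \<open>The form attains a positive minimum \<open>c\<close> on the unit sphere, and it is homogeneous of degree
  two.\<close>

lemma pos_definite_coercive:
  fixes M :: "real^'m^'m"
  assumes "pos_definite M"
  obtains c where "0 < c" "\<And>v. c * (norm v)\<^sup>2 \<le> v \<bullet> (M *v v)"
proof -
  have cont: "continuous_on (sphere 0 1) (\<lambda>v. v \<bullet> (M *v v))"
    by (intro continuous_intros)
  have "\<exists>v::real^'m. norm v = 1"
    by (meson vector_choose_size zero_le_one)
  then have "sphere (0::real^'m) 1 \<noteq> {}"
    by auto
  then obtain w where w: "w \<in> sphere 0 1" "\<And>v. v \<in> sphere 0 1 \<Longrightarrow> w \<bullet> (M *v w) \<le> v \<bullet> (M *v v)"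
    using continuous_attains_inf[OF compact_sphere _ cont] by blast
  show ?thesis
  proof
    show "0 < w \<bullet> (M *v w)"
      using assms w(1) unfolding pos_definite_def by (metis dist_0_norm mem_sphere norm_zero zero_neq_one)
    fix v :: "real^'m"
    show "(w \<bullet> (M *v w)) * (norm v)\<^sup>2 \<le> v \<bullet> (M *v v)"
    proof (cases "v = 0")
      case False
      define u where "u = (1 / norm v) *\<^sub>R v"
      have u: "u \<in> sphere 0 1" "v = norm v *\<^sub>R u"
        using False by (auto simp: u_def)
      have "v \<bullet> (M *v v) = (norm v)\<^sup>2 * (u \<bullet> (M *v u))"
        by (subst (1 2) u(2)) (simp add: matrix_vector_mult_scaleR power2_eq_square)
      with w(2)[OF u(1)] show ?thesis
        by (metis mult.commute mult_right_mono zero_le_power2)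
    qed simp
  qed
qed

lemma neg_definite_coercive:
  fixes M :: "real^'m^'m"
  assumes "neg_definite M"
  obtains c where "0 < c" "\<And>v. v \<bullet> (M *v v) \<le> - c * (norm v)\<^sup>2"
proof -
  have neg: "(- M) *v v = - (M *v v)" for v
    by (metis diff_0 matrix_vector_mult_0 matrix_vector_mult_diff_rdistrib)
  have "transpose (- M) = - transpose M"
    by (simp add: transpose_def vec_eq_iff)
  then have "pos_definite (- M)"
    using assms unfolding neg_definite_def pos_definite_def by (simp add: neg)
  then obtain c where "0 < c" "\<And>v. c * (norm v)\<^sup>2 \<le> v \<bullet> ((- M) *v v)"
    using pos_definite_coercive by blast
  then show ?thesis
    using that[of c] by (simp add: neg le_minus_iff)
qed

lemma inner_matrix_vector_mult:
  fixes M :: "real^'m^'k"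
  shows "x \<bullet> (M *v y) = (transpose M *v x) \<bullet> y"
  by (simp add: transpose_matrix_vector dot_lmul_matrix)

text \<open>For symmetric \<open>P\<close> this turns the matrix expressions of the Lyapunov inequalities into
  derivatives of the quadratic form of \<open>P\<close> along the linear field \<open>M\<close>.\<close>

lemma inner_symmetric_part:
  fixes P M :: "real^'m^'m"
  assumes "transpose P = P"
  shows "v \<bullet> ((transpose M ** P + P ** M) *v v) = 2 * (v \<bullet> (P *v (M *v v)))"
proof -
  have "v \<bullet> (transpose M *v (P *v v)) = v \<bullet> (P *v (M *v v))"
    unfolding inner_matrix_vector_mult[of v "transpose M"] inner_matrix_vector_mult[of v P]
    by (simp add: assms inner_commute)
  then show ?thesis
    by (simp add: matrix_vector_mult_add_rdistrib inner_add_right matrix_vector_mul_assoc[symmetric])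
qed

definition block_vector :: "real^'a \<Rightarrow> real^'b \<Rightarrow> real^('a + 'b)" where
  "block_vector x y = (\<chi> i. case i of Inl a \<Rightarrow> x $ a | Inr b \<Rightarrow> y $ b)"

lemma sum_UNIV_Plus:
  fixes g :: "'a::finite + 'b::finite \<Rightarrow> real"
  shows "sum g UNIV = (\<Sum>a\<in>UNIV. g (Inl a)) + (\<Sum>b\<in>UNIV. g (Inr b))"
  by (subst UNIV_Plus_UNIV[symmetric], subst sum.Plus) auto

lemma inner_block_vector:
  "block_vector x y \<bullet> block_vector x' y' = x \<bullet> x' + y \<bullet> y'"
  by (simp add: inner_vec_def sum_UNIV_Plus block_vector_def)

lemma block_matrix_mult_block_vector:
  "block_matrix M11 M12 M21 M22 *v block_vector x y =
    block_vector (M11 *v x + M12 *v y) (M21 *v x + M22 *v y)"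
  by (auto simp: vec_eq_iff matrix_vector_mult_def sum_UNIV_Plus block_vector_def
      block_matrix_def split: sum.split)

section \<open>The closed loop\<close>

lemma linear_lipschitz_on:
  fixes f :: "'a::euclidean_space \<Rightarrow> 'b::real_normed_vector"
  assumes "linear f"
  shows "\<exists>L. L-lipschitz_on S f"
proof -
  have "bounded_linear f"
    using assms by (simp add: linear_conv_bounded_linear)
  then show ?thesis
    by (rule bounded_linear.lipschitz_boundE) blast
qed

lemma lipschitz_on_bounded_image:
  fixes f :: "'s::euclidean_space \<Rightarrow> 'a::euclidean_space"
  assumes "\<exists>L. L-lipschitz_on S f" and "bounded S"
  obtains B where "0 \<le> B" "\<And>x. x \<in> S \<Longrightarrow> norm (f x) \<le> B"
proof -
  obtain L where "L-lipschitz_on S f" using assms(1) by blast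
  then have "bounded (f ` S)"
    using assms(2) by (simp add: bounded_uniformly_continuous_image lipschitz_on_uniformly_continuous)
  then obtain B where "0 < B" "\<And>x. x \<in> S \<Longrightarrow> norm (f x) \<le> B"
    by (auto simp: bounded_pos)
  then show ?thesis using that[of B] by simp
qed

lemma lipschitz_on_bounded_bilinear:
  fixes f :: "'s::euclidean_space \<Rightarrow> 'a::euclidean_space" and g :: "'s \<Rightarrow> 'b::euclidean_space"
  assumes p: "bounded_bilinear p" and S: "bounded S"
    and f: "\<exists>L. L-lipschitz_on S f" and g: "\<exists>L. L-lipschitz_on S g"
  shows "\<exists>L. L-lipschitz_on S (\<lambda>x. p (f x) (g x))"
proof -
  obtain Lf Lg where Lf: "Lf-lipschitz_on S f" and Lg: "Lg-lipschitz_on S g"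
    using f g by blast
  obtain Bf Bg where Bf: "0 \<le> Bf" "\<And>x. x \<in> S \<Longrightarrow> norm (f x) \<le> Bf"
    and Bg: "0 \<le> Bg" "\<And>x. x \<in> S \<Longrightarrow> norm (g x) \<le> Bg"
    using lipschitz_on_bounded_image[OF f S] lipschitz_on_bounded_image[OF g S] by metis
  obtain K where K: "0 < K" "\<And>a b. norm (p a b) \<le> norm a * norm b * K"
    using bounded_bilinear.pos_bounded[OF p] by blast
  have L0: "0 \<le> Lf" "0 \<le> Lg"
    using Lf Lg by (auto dest: lipschitz_on_nonneg)
  have "((Bf * Lg + Lf * Bg) * K)-lipschitz_on S (\<lambda>x. p (f x) (g x))"
  proof (rule lipschitz_onI)
    fix x y assume xy: "x \<in> S" "y \<in> S"
    have "p (f x) (g x) - p (f y) (g y) = p (f x) (g x - g y) + p (f x - f y) (g y)"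
      by (simp add: bounded_bilinear.diff_left[OF p] bounded_bilinear.diff_right[OF p])
    also have "norm \<dots> \<le> norm (f x) * norm (g x - g y) * K + norm (f x - f y) * norm (g y) * K"
      by (intro norm_triangle_le add_mono K)
    also have "\<dots> \<le> Bf * (Lg * dist x y) * K + (Lf * dist x y) * Bg * K"
      using lipschitz_onD[OF Lf xy] lipschitz_onD[OF Lg xy] Bf Bg K(1) L0 xy
      by (intro add_mono mult_mono mult_right_mono) (auto simp: dist_norm)
    finally show "dist (p (f x) (g x)) (p (f y) (g y)) \<le> (Bf * Lg + Lf * Bg) * K * dist x y"
      by (simp add: dist_norm algebra_simps)
  qed (use L0 K Bf Bg in auto)
  then show ?thesis by blast
qed

text \<open>The closed loop is a linear map minus a product of linear maps, and products of Lipschitz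
  functions are Lipschitz on bounded sets.\<close>

lemma closed_loop_lipschitz_on_bounded:
  fixes A :: "real^'n^'n" and S :: "((real^'n) \<times> (real^'n)) set"
  assumes S: "bounded S"
  shows "\<exists>L. L-lipschitz_on S (closed_loop A B C K Lc Nc \<theta>)"
proof -
  define l where "l = (\<lambda>(x::real^'n, xh::real^'n). (A *v x - B *v (K *v xh),
    (A - Lc ** C) *v xh + Lc *v (C *v x) - B *v (K *v xh)))"
  define e where "e = (\<lambda>(x::real^'n, xh::real^'n). x - xh)"
  define M where "M = transpose C ** \<theta> ** C"
  define n where "n = (\<lambda>z. (0::real^'n, Nc *v (C *v e z)))"
  note lin = matrix_vector_right_distrib matrix_vector_mult_diff_distrib
    matrix_vector_mult_scaleR scaleR_diff_right scaleR_right_distrib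
  have l: "linear l"
    by (rule linearI) (auto simp: l_def lin algebra_simps)
  have e: "linear e"
    by (rule linearI) (auto simp: e_def scaleR_diff_right)
  have n: "linear n"
    by (rule linearI) (simp_all add: n_def linear_add[OF e] linear_scale[OF e] lin)
  have m: "linear (\<lambda>z. M *v e z)"
    by (rule linearI) (simp_all add: linear_add[OF e] linear_scale[OF e] lin)
  note lip = l[THEN linear_lipschitz_on] e[THEN linear_lipschitz_on]
    n[THEN linear_lipschitz_on] m[THEN linear_lipschitz_on]
  have "\<exists>L. L-lipschitz_on S (\<lambda>z. (e z \<bullet> (M *v e z)) *\<^sub>R n z)"
    by (intro lipschitz_on_bounded_bilinear[OF bounded_bilinear_scaleR S]
        lipschitz_on_bounded_bilinear[OF bounded_bilinear_inner S] lip)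
  then have "\<exists>L. L-lipschitz_on S (\<lambda>z. l z - (e z \<bullet> (M *v e z)) *\<^sub>R n z)"
    using lip(1) lipschitz_on_diff by blast
  moreover have "closed_loop A B C K Lc Nc \<theta> = (\<lambda>z. l z - (e z \<bullet> (M *v e z)) *\<^sub>R n z)"
    by (auto simp: fun_eq_iff l_def e_def n_def M_def closed_loop_def plant_def
        cubic_observer_def Let_def linear_neg[OF matrix_vector_mul_linear])
  ultimately show ?thesis by (simp only:)
qed

text \<open>The polarization of \<open>V\<close>, written in the coordinates \<open>(x, xh)\<close> of the closed loop.\<close>

definition lyapunov_form ::
  "real^'n^'n \<Rightarrow> real^'n^'n \<Rightarrow> (real^'n) \<times> (real^'n) \<Rightarrow> (real^'n) \<times> (real^'n) \<Rightarrow> real" where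
  "lyapunov_form P1 P = (\<lambda>(x, xh) (x', xh').
     x \<bullet> (P1 *v x') + (x - xh) \<bullet> (P *v (x' - xh')))"

lemma bounded_bilinear_lyapunov_form: "bounded_bilinear (lyapunov_form P1 P)"
  unfolding bilinear_conv_bounded_bilinear[symmetric] bilinear_def
  by (auto intro!: linearI simp: lyapunov_form_def matrix_vector_right_distrib
      matrix_vector_mult_diff_distrib matrix_vector_mult_scaleR algebra_simps
      inner_simps)

lemma lyapunov_form_sym:
  assumes "transpose P1 = P1" "transpose P = P"
  shows "lyapunov_form P1 P z w = lyapunov_form P1 P w z"
proof -
  have "u \<bullet> (M *v v) = v \<bullet> (M *v u)" if "transpose M = M" for M :: "real^'n^'n" and u v
    by (subst inner_matrix_vector_mult) (simp add: that inner_commute)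
  from this[OF assms(1)] this[OF assms(2)] show ?thesis
    unfolding lyapunov_form_def case_prod_beta by metis
qed

text \<open>Passing from \<open>(x, x - xh)\<close> back to the state \<open>(x, xh)\<close> changes the squared norm by a bounded
  factor, so coercivity may be checked in either coordinates.\<close>

lemma norm_state_le_error_coordinates:
  fixes x xh :: "'a::real_inner"
  shows "(norm (x, xh))\<^sup>2 \<le> 3 * ((norm x)\<^sup>2 + (norm (x - xh))\<^sup>2)"
proof -
  have "norm xh \<le> norm x + norm (x - xh)"
    by (metis norm_minus_commute norm_triangle_sub)
  then have "(norm xh)\<^sup>2 \<le> (norm x + norm (x - xh))\<^sup>2"
    by (simp add: power_mono)
  also have "\<dots> \<le> 2 * (norm x)\<^sup>2 + 2 * (norm (x - xh))\<^sup>2"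
    using sum_squares_bound[of "norm x" "norm (x - xh)"] by (simp add: power2_sum)
  finally show ?thesis
    by (simp add: norm_Pair) (smt (verit) zero_le_power2)
qed

lemma lyapunov_form_coercive:
  assumes "pos_definite P1" "pos_definite P"
  obtains a where "0 < a" "\<And>z. a * (norm z)\<^sup>2 \<le> lyapunov_form P1 P z z"
proof -
  obtain c1 c2 where c: "0 < c1" "0 < c2"
    "\<And>v. c1 * (norm v)\<^sup>2 \<le> v \<bullet> (P1 *v v)" "\<And>v. c2 * (norm v)\<^sup>2 \<le> v \<bullet> (P *v v)"
    using pos_definite_coercive assms by metis
  define m where "m = min c1 c2"
  have "m / 3 * (norm (x, xh))\<^sup>2 \<le> lyapunov_form P1 P (x, xh) (x, xh)" for x xh
  proof -
    have "m / 3 * (norm (x, xh))\<^sup>2 \<le> m / 3 * (3 * ((norm x)\<^sup>2 + (norm (x - xh))\<^sup>2))"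
      using c by (intro mult_left_mono norm_state_le_error_coordinates) (auto simp: m_def)
    also have "\<dots> = m * (norm x)\<^sup>2 + m * (norm (x - xh))\<^sup>2"
      by (simp add: algebra_simps)
    also have "\<dots> \<le> c1 * (norm x)\<^sup>2 + c2 * (norm (x - xh))\<^sup>2"
      by (intro add_mono mult_right_mono) (auto simp: m_def)
    also have "\<dots> \<le> lyapunov_form P1 P (x, xh) (x, xh)"
      using c by (simp add: lyapunov_form_def add_mono)
    finally show ?thesis .
  qed
  then show ?thesis
    using that[of "m / 3"] c by (auto simp: m_def)
qed

text \<open>The field is linear in \<open>(x, e)\<close> up to the cubic term, which enters only the error equation.
  The linear part produces the quadratic form of the block matrix; its two off-diagonal blocks are
  transposes of each other and each contributes \<open>x\<^sup>T P1 B K e\<close>.\<close>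

lemma lyapunov_form_closed_loop:
  fixes A :: "real^'n^'n" and B :: "real^'u^'n" and C :: "real^'n^'y"
    and K :: "real^'n^'u" and Lc Nc :: "real^'y^'n" and \<theta> :: "real^'y^'y"
    and P P1 :: "real^'n^'n"
  assumes P1: "transpose P1 = P1" and P: "transpose P = P"
  defines "M \<equiv> block_matrix
           (transpose (A - B ** K) ** P1 + P1 ** (A - B ** K))
           (P1 ** B ** K)
           (transpose K ** transpose B ** P1)
           (transpose (A - Lc ** C) ** P + P ** (A - Lc ** C))"
  shows "2 * lyapunov_form P1 P (x, x - e) (closed_loop A B C K Lc Nc \<theta> (x, x - e)) =
    block_vector x e \<bullet> (M *v block_vector x e)
    + (e \<bullet> ((transpose C ** \<theta> ** C) *v e))
      * (e \<bullet> ((P ** Nc ** C + transpose C ** transpose Nc ** P) *v e))"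
proof -
  obtain dx dxh where d: "closed_loop A B C K Lc Nc \<theta> (x, x - e) = (dx, dxh)"
    by fastforce
  note de = closed_loop_error_coordinates[OF d]
  define q where "q = e \<bullet> ((transpose C ** \<theta> ** C) *v e)"
  have cross: "e \<bullet> ((transpose K ** transpose B ** P1) *v x) = x \<bullet> ((P1 ** B ** K) *v e)"
  proof -
    have "transpose K ** transpose B ** P1 = transpose (P1 ** B ** K)"
      by (simp add: matrix_transpose_mul P1 matrix_mul_assoc)
    then show ?thesis
      by (simp add: inner_matrix_vector_mult[of x] inner_commute)
  qed
  have "P ** Nc ** C + transpose C ** transpose Nc ** P
      = transpose (Nc ** C) ** P + P ** (Nc ** C)"
    by (simp add: matrix_transpose_mul matrix_mul_assoc add.commute)
  then have N: "e \<bullet> ((P ** Nc ** C + transpose C ** transpose Nc ** P) *v e)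
      = 2 * (e \<bullet> (P *v ((Nc ** C) *v e)))"
    by (simp only: inner_symmetric_part[OF P])
  have "2 * lyapunov_form P1 P (x, x - e) (dx, dxh)
      = 2 * (x \<bullet> (P1 *v dx)) + 2 * (e \<bullet> (P *v (dx - dxh)))"
    by (simp add: lyapunov_form_def)
  also have "x \<bullet> (P1 *v dx) = x \<bullet> (P1 *v ((A - B ** K) *v x)) + x \<bullet> ((P1 ** B ** K) *v e)"
    unfolding de(1)
    by (simp add: matrix_vector_right_distrib inner_add_right matrix_vector_mul_assoc matrix_mul_assoc)
  also have "e \<bullet> (P *v (dx - dxh)) = e \<bullet> (P *v ((A - Lc ** C) *v e)) + q * (e \<bullet> (P *v ((Nc ** C) *v e)))"
    unfolding de(2) q_def
    by (simp add: matrix_vector_right_distrib inner_add_right matrix_vector_mult_scaleR)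
  finally have V: "2 * lyapunov_form P1 P (x, x - e) (dx, dxh) =
      2 * (x \<bullet> (P1 *v ((A - B ** K) *v x))) + 2 * (x \<bullet> ((P1 ** B ** K) *v e))
      + 2 * (e \<bullet> (P *v ((A - Lc ** C) *v e))) + q * (2 * (e \<bullet> (P *v ((Nc ** C) *v e))))"
    by (simp add: algebra_simps)
  have "block_vector x e \<bullet> (M *v block_vector x e) =
      2 * (x \<bullet> (P1 *v ((A - B ** K) *v x))) + 2 * (x \<bullet> ((P1 ** B ** K) *v e))
      + 2 * (e \<bullet> (P *v ((A - Lc ** C) *v e)))"
    unfolding M_def block_matrix_mult_block_vector inner_block_vector inner_add_right
      inner_symmetric_part[OF P1] inner_symmetric_part[OF P] cross
    by simp
  then show ?thesis
    unfolding d V N q_def by simp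
qed

theorem theorem6:
  fixes A :: "real^'n^'n" and B :: "real^'u^'n" and C :: "real^'n^'y"
    and K :: "real^'n^'u" and Lc Nc :: "real^'y^'n" and \<theta> :: "real^'y^'y"
    and P P1 :: "real^'n^'n"
  assumes "observable A C"
    and "pos_semidefinite \<theta>"
    and "pos_definite P"
    and "\<not> (\<exists>v. v \<noteq> 0 \<and>
           (A - Lc ** C) *v v
             + (v \<bullet> ((transpose C ** \<theta> ** C) *v v)) *\<^sub>R ((Nc ** C) *v v) = 0)"
    and "neg_definite (transpose (A - Lc ** C) ** P + P ** (A - Lc ** C))"
    and "neg_definite (P ** Nc ** C + transpose C ** transpose Nc ** P)"
    and "pos_definite P1"
    and "neg_definite (block_matrix
           (transpose (A - B ** K) ** P1 + P1 ** (A - B ** K))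
           (P1 ** B ** K)
           (transpose K ** transpose B ** P1)
           (transpose (A - Lc ** C) ** P + P ** (A - Lc ** C)))"
  shows "globally_asymptotically_stable (closed_loop A B C K Lc Nc \<theta>)"
proof -
  let ?f = "closed_loop A B C K Lc Nc \<theta>" and ?\<beta> = "lyapunov_form P1 P"
  have sym: "transpose P1 = P1" "transpose P = P"
    using assms(3,7) by (auto simp: pos_definite_def)
  obtain a where a: "0 < a" "\<And>z. a * (norm z)\<^sup>2 \<le> ?\<beta> z z"
    using lyapunov_form_coercive assms(3,7) by blast
  obtain c where c: "0 < c" "\<And>w. w \<bullet> (block_matrix
           (transpose (A - B ** K) ** P1 + P1 ** (A - B ** K))
           (P1 ** B ** K)
           (transpose K ** transpose B ** P1)
           (transpose (A - Lc ** C) ** P + P ** (A - Lc ** C)) *v w) \<le> - c * (norm w)\<^sup>2"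
    using neg_definite_coercive[OF assms(8)] by blast
  have "2 * ?\<beta> z (?f z) \<le> - (c / 3) * (norm z)\<^sup>2" for z
  proof -
    obtain x xh where z: "z = (x, xh)" by fastforce
    define e where "e = x - xh"
    have xh: "xh = x - e" by (simp add: e_def)
    have "e \<bullet> ((transpose C ** \<theta> ** C) *v e) = (C *v e) \<bullet> (\<theta> *v (C *v e))"
      by (simp only: inner_matrix_vector_mult[of e "transpose C"] matrix_vector_mul_assoc[symmetric]
          transpose_transpose)
    then have "0 \<le> e \<bullet> ((transpose C ** \<theta> ** C) *v e)"
      using assms(2) by (simp add: pos_semidefinite_def)
    moreover have "e \<bullet> ((P ** Nc ** C + transpose C ** transpose Nc ** P) *v e) \<le> 0"
      using assms(6) by (cases "e = 0") (auto simp: neg_definite_def less_imp_le)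
    ultimately have "2 * ?\<beta> z (?f z) \<le> - c * (norm (block_vector x e))\<^sup>2"
      unfolding z xh lyapunov_form_closed_loop[OF sym]
      using c(2)[of "block_vector x e"] by (smt (verit) mult_nonneg_nonpos)
    also have "\<dots> = - (c / 3) * (3 * ((norm x)\<^sup>2 + (norm e)\<^sup>2))"
      by (simp add: power2_norm_eq_inner inner_block_vector)
    also have "\<dots> \<le> - (c / 3) * (norm z)\<^sup>2"
      unfolding z e_def using c(1)
      by (intro mult_left_mono_neg norm_state_le_error_coordinates) auto
    finally show ?thesis .
  qed
  moreover have "?f 0 = 0"
    by (simp add: closed_loop_def zero_prod_def plant_def cubic_observer_def)
  ultimately show ?thesis
    using c(1) a
    by (intro quadratic_lyapunov_imp_globally_asymptotically_stable[of ?\<beta> a "c / 3"]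
        bounded_bilinear_lyapunov_form lyapunov_form_sym[OF sym]
        closed_loop_lipschitz_on_bounded bounded_cball) auto
qed

end
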